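(* There exists a universal constant $c>0$ such that for every integer $n\geq1$ and every origin-symmetric convex body $K\subseteq\mathbb{R}^n$ with $\dim(K\cap\mathbb{Z}^n)=n$ there exist linearly independent vectors $\mathbf{v}_1,\dots,\mathbf{v}_n\in\mathbb{Z}^n$ such that $$\#(K)^{\frac{n-1}{n}} \geq c^n\Big(\prod_{i=1}^n \#_{\mathbb{Z}^n|\mathbf{v}_i^\perp}(K|\mathbf{v}_i^\perp)\Big)^{\frac1n},$$ where $\#_{\mathbb{Z}^n|\mathbf{v}_i^\perp}(K|\mathbf{v}_i^\perp)=\big|(K|\mathbf{v}_i^\perp)\cap(\mathbb{Z}^n|\mathbf{v}_i^\perp)\big|$.
   Context: A convex body in $\mathbb{R}^n$ is a compact convex set; it is origin-symmetric if $K=-K$. $\#(K)=|K\cap\mathbb{Z}^n|$ is the number of integer points in $K$. $\dim(K\cap\mathbb{Z}^n)=n$ means that $K\cap\mathbb{Z}^n$ spans $\mathbb{R}^n$, i.e. $K$ contains $n$ linearly independent integer points. For $\mathbf{v}\neq\mathbf{0}$, $\mathbf{v}^\perp=\{\mathbf{x}\in\mathbb{R}^n:\langle\mathbf{x},\mathbf{v}\rangle=0\}$, and for $A\subseteq\mathbb{R}^n$, $A|\mathbf{v}^\perp$ denotes the image of $A$ under the orthogonal projection of $\mathbb{R}^n$ onto $\mathbf{v}^\perp$; for $\mathbf v\in\mathbb{Z}^n\setminus\{\mathbf 0\}$, $\mathbb{Z}^n|\mathbf{v}^\perp$ is a lattice in $\mathbf{v}^\perp$. *)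

theory Defs
  imports "HOL-Analysis.Analysis" "HOL-Library.Function_Algebras"
begin

text \<open>
  The constant of the theorem is uniform in the dimension, so the dimension must be a
  natural-number variable under a quantifier and cannot be a type.  Points of \<open>\<real>\<^sup>n\<close> are
  therefore sequences of type \<^typ>\<open>nat \<Rightarrow> real\<close> vanishing from index \<open>n\<close> on, as in the library's
  \<^const>\<open>Euclidean_space\<close>.  With the pointwise vector space structure declared here, the
  library's \<^const>\<open>convex\<close>, \<^const>\<open>independent\<close> and \<^const>\<open>dim\<close> apply.  The library's topology on
  functions is the product topology; on \<open>\<real>\<^sup>n\<close> it is the Euclidean one, so \<^const>\<open>compact\<close>
  has its usual meaning for subsets of \<open>\<real>\<^sup>n\<close>.
\<close>

instantiation "fun" :: (type, real_vector) real_vector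
begin

definition scaleR_fun :: "real \<Rightarrow> ('a \<Rightarrow> 'b) \<Rightarrow> 'a \<Rightarrow> 'b" where
  "scaleR_fun r f = (\<lambda>x. r *\<^sub>R f x)"

instance
  by standard (simp_all add: scaleR_fun_def fun_eq_iff scaleR_add_right scaleR_add_left)

end

definition Rn :: "nat \<Rightarrow> (nat \<Rightarrow> real) set" where
  "Rn n = {x. \<forall>i\<ge>n. x i = 0}"

definition Zn :: "nat \<Rightarrow> (nat \<Rightarrow> real) set" where
  "Zn n = {x \<in> Rn n. \<forall>i. x i \<in> \<int>}"

definition ip :: "nat \<Rightarrow> (nat \<Rightarrow> real) \<Rightarrow> (nat \<Rightarrow> real) \<Rightarrow> real" where
  "ip n x y = (\<Sum>i<n. x i * y i)"

definition perp :: "nat \<Rightarrow> (nat \<Rightarrow> real) \<Rightarrow> (nat \<Rightarrow> real) set" where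
  "perp n v = {x \<in> Rn n. ip n x v = 0}"

definition proj_perp :: "nat \<Rightarrow> (nat \<Rightarrow> real) \<Rightarrow> (nat \<Rightarrow> real) \<Rightarrow> nat \<Rightarrow> real" where
  "proj_perp n v x = x - (ip n x v / ip n v v) *\<^sub>R v"

definition symmetric_convex_body :: "nat \<Rightarrow> (nat \<Rightarrow> real) set \<Rightarrow> bool" where
  "symmetric_convex_body n K \<longleftrightarrow> K \<subseteq> Rn n \<and> compact K \<and> convex K \<and> uminus ` K = K"

definition num_points :: "(nat \<Rightarrow> real) set \<Rightarrow> (nat \<Rightarrow> real) set \<Rightarrow> nat" where
  "num_points L K = card (K \<inter> L)"

lemma Rn_eq_topspace: "Rn n = topspace (Euclidean_space n)"
  by (simp add: Rn_def topspace_Euclidean_space)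

lemma ip_diff_left: "ip n (x - y) z = ip n x z - ip n y z"
  by (simp add: ip_def left_diff_distrib sum_subtractf)

lemma ip_scaleR_left: "ip n (r *\<^sub>R x) z = r * ip n x z"
  by (simp add: ip_def scaleR_fun_def sum_distrib_left mult.assoc)

lemma ip_commute: "ip n x y = ip n y x"
  by (simp add: ip_def mult.commute)

lemma ip_self_eq_0:
  assumes "x \<in> Rn n" and "ip n x x = 0"
  shows "x = 0"
proof
  fix i
  have "\<forall>i\<in>{..<n}. x i * x i = 0"
    using assms(2) by (simp add: ip_def sum_nonneg_eq_0_iff)
  then show "x i = 0 i"
    using assms(1) by (cases "i < n") (auto simp: Rn_def)
qed

text \<open>\<^term>\<open>proj_perp n v\<close> is the orthogonal projection of \<open>\<real>\<^sup>n\<close> onto \<open>v\<^sup>\<bottom>\<close>.\<close>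

lemma proj_perp_eq_iff:
  assumes v: "v \<in> Rn n" "v \<noteq> 0" and x: "x \<in> Rn n"
  shows "proj_perp n v x = y \<longleftrightarrow> y \<in> perp n v \<and> (\<forall>z\<in>perp n v. ip n (x - y) z = 0)"
proof -
  have vv: "ip n v v \<noteq> 0"
    using ip_self_eq_0 v by blast
  have "ip n (proj_perp n v x) v = 0"
    using vv by (simp add: proj_perp_def ip_diff_left ip_scaleR_left)
  moreover have "proj_perp n v x \<in> Rn n"
    using v x by (simp add: proj_perp_def Rn_def scaleR_fun_def)
  ultimately have mem: "proj_perp n v x \<in> perp n v"
    by (simp add: perp_def)
  have orth: "ip n (x - proj_perp n v x) z = 0" if "z \<in> perp n v" for z
    using that ip_commute[of n v z] by (simp add: proj_perp_def perp_def ip_scaleR_left)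
  have "y = proj_perp n v x"
    if y: "y \<in> perp n v" and o: "\<And>z. z \<in> perp n v \<Longrightarrow> ip n (x - y) z = 0"
  proof -
    let ?d = "proj_perp n v x - y"
    have d: "?d \<in> perp n v"
      using mem y by (auto simp: perp_def Rn_def ip_diff_left)
    have "ip n ?d ?d = ip n (x - y) ?d - ip n (x - proj_perp n v x) ?d"
      unfolding ip_diff_left by simp
    also have "\<dots> = 0"
      using o orth d by simp
    finally have "?d = 0"
      using d ip_self_eq_0[of ?d n] unfolding perp_def by blast
    then show ?thesis by simp
  qed
  with mem orth show ?thesis by blast
qed

end

theory Submission
  imports Defs "HOL-Library.Discrete_Functions"
begin

text \<open>
  Let \<open>N(w)\<close> be the largest \<open>k\<close> with \<open>k w \<in> K\<close>, and choose \<open>v\<^sub>1, \<dots>, v\<^sub>n\<close> greedily so that \<open>v\<^sub>i\<close>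
  maximizes \<open>N\<close> among the lattice vectors outside the span of its predecessors.  Lifting the points of
  the projection along \<open>v\<^sub>i\<close> to \<open>2K\<close> and reducing modulo 4 gives
  \<open>#(K|v\<^sub>i\<^sup>\<bottom>) N(v\<^sub>i) \<le> #(2K) \<le> 4\<^sup>n #(K)\<close>.  Conversely \<open>#(K) \<le> 4\<^sup>n \<Prod> N(v\<^sub>i)\<close>, by the argument of
  Betke, Henk and Wills: in a lattice basis adapted to the flag of the \<open>v\<^sub>i\<close>, points of \<open>K\<close> are separated
  by their coordinates modulo \<open>q\<^sub>i\<close>, where \<open>q\<^sub>i \<in> (2 N(v\<^sub>i), 4 N(v\<^sub>i)]\<close> is a power of two; powers of two
  make the \<open>q\<^sub>i\<close> a divisor chain.  Multiplying, \<open>\<Prod> #(K|v\<^sub>i\<^sup>\<bottom>) \<le> 4\<^bsup>n\<^sup>2 + n\<^esup> #(K)\<^bsup>n - 1\<^esup>\<close>.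
\<close>

section \<open>Lattice points and symmetric convex bodies\<close>

lemma sum_fun_apply: "(\<Sum>i\<in>A. f i) x = (\<Sum>i\<in>A. (f i x :: real))"
  by (induction A rule: infinite_finite_induct) auto

lemma scaleR_fun_apply [simp]: "(r *\<^sub>R f) x = r *\<^sub>R f x"
  by (simp add: scaleR_fun_def)

lemma Zn_add: "x \<in> Zn n \<Longrightarrow> y \<in> Zn n \<Longrightarrow> x + y \<in> Zn n"
  by (simp add: Zn_def Rn_def)

lemma Zn_diff: "x \<in> Zn n \<Longrightarrow> y \<in> Zn n \<Longrightarrow> x - y \<in> Zn n"
  by (simp add: Zn_def Rn_def)

lemma Zn_scaleR_of_int: "x \<in> Zn n \<Longrightarrow> of_int m *\<^sub>R x \<in> Zn n"
  by (simp add: Zn_def Rn_def)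

lemma Zn_sum_scaleR_of_int:
  "(\<And>i. i \<in> A \<Longrightarrow> f i \<in> Zn n) \<Longrightarrow> (\<Sum>i\<in>A. of_int (z i) *\<^sub>R f i) \<in> Zn n"
proof (induction A rule: infinite_finite_induct)
  case (insert x F)
  show ?case
    unfolding sum.insert[OF insert.hyps]
    by (intro Zn_add Zn_scaleR_of_int insert.IH insert.prems) simp_all
qed (simp_all add: Zn_def Rn_def)

text \<open>Integer coordinates are recovered from their floors, so the box embeds in a finite
  product of integer intervals.\<close>

lemma finite_Zn_box: "finite {x \<in> Zn n. \<forall>i<n. \<bar>x i\<bar> \<le> B}"
proof (rule finite_imageD)
  let ?S = "{x \<in> Zn n. \<forall>i<n. \<bar>x i\<bar> \<le> B}"
  let ?f = "\<lambda>x. restrict (\<lambda>i. \<lfloor>x i\<rfloor>) {..<n}"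
  show "finite (?f ` ?S)"
  proof (rule finite_subset)
    have "\<lfloor>x i\<rfloor> \<in> {\<lfloor>-B\<rfloor>..\<lfloor>B\<rfloor>}" if "\<bar>x i\<bar> \<le> B" for x :: "nat \<Rightarrow> real" and i
      using that unfolding atLeastAtMost_iff by (intro conjI floor_mono) linarith+
    then show "?f ` ?S \<subseteq> PiE {..<n} (\<lambda>_. {\<lfloor>-B\<rfloor>..\<lfloor>B\<rfloor>})"
      by (intro image_subsetI restrict_PiE_iff[THEN iffD2]) blast
  qed (auto intro: finite_PiE)
  show "inj_on ?f ?S"
  proof (rule inj_onI)
    fix x y assume xy: "x \<in> ?S" "y \<in> ?S" and eq: "?f x = ?f y"
    show "x = y"
    proof
      fix i
      show "x i = y i"
      proof (cases "i < n")
        case True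
        then have "\<lfloor>x i\<rfloor> = \<lfloor>y i\<rfloor>" using fun_cong[OF eq, of i] by simp
        moreover have "x i \<in> \<int>" "y i \<in> \<int>" using xy by (auto simp: Zn_def)
        ultimately show ?thesis by (metis Ints_cases floor_of_int)
      next
        case False
        then show ?thesis using xy by (simp add: Zn_def Rn_def)
      qed
    qed
  qed
qed

lemma body_coordinates_bounded:
  assumes "symmetric_convex_body n K"
  obtains B where "\<And>x i. x \<in> K \<Longrightarrow> \<bar>x i\<bar> \<le> B"
proof -
  have K: "K \<subseteq> Rn n" "compact K" using assms by (auto simp: symmetric_convex_body_def)
  have "\<exists>b. \<forall>x\<in>K. \<bar>x i\<bar> \<le> b" for i
  proof -
    have "compact ((\<lambda>x. x i) ` K)"
      using K(2) by (intro compact_continuous_image continuous_on_subset[OF continuous_on_product_coordinates]) auto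
    then have "bounded ((\<lambda>x. x i) ` K)" by (rule compact_imp_bounded)
    then show ?thesis by (auto simp: bounded_iff)
  qed
  then obtain b where b: "\<And>i x. x \<in> K \<Longrightarrow> \<bar>x i\<bar> \<le> b i" by metis
  \<comment> \<open>The sum dominates the bounds for \<open>i < n\<close>, and the coordinates from
    \<open>n\<close> on vanish on \<open>K\<close>, so one bound serves all
    \<open>i\<close>.\<close>
  have "\<bar>x i\<bar> \<le> (\<Sum>i<n. \<bar>b i\<bar>)" if "x \<in> K" for x i
  proof (cases "i < n")
    case True
    have "\<bar>x i\<bar> \<le> \<bar>b i\<bar>" using b[OF that, of i] by simp
    also have "\<dots> \<le> (\<Sum>i<n. \<bar>b i\<bar>)" using True by (intro member_le_sum) auto
    finally show ?thesis .
  next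
    case False
    then show ?thesis using that K(1) by (auto simp: Rn_def sum_nonneg)
  qed
  then show ?thesis using that by blast
qed

lemma finite_body_Zn:
  assumes "symmetric_convex_body n K"
  shows "finite (K \<inter> Zn n)"
proof -
  obtain B where "\<And>x i. x \<in> K \<Longrightarrow> \<bar>x i\<bar> \<le> B" using body_coordinates_bounded[OF assms] by blast
  then show ?thesis by (intro finite_subset[OF _ finite_Zn_box[of n B]]) auto
qed

lemma body_uminus: "symmetric_convex_body n K \<Longrightarrow> x \<in> K \<Longrightarrow> - x \<in> K"
  unfolding symmetric_convex_body_def by blast

lemma body_midpoint:
  assumes "symmetric_convex_body n K" "x \<in> K" "y \<in> K"
  shows "(1/2) *\<^sub>R (x + y) \<in> K"
  using convexD[of K x y "1/2" "1/2"] assms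
  by (simp add: symmetric_convex_body_def scaleR_add_right)

lemma body_scaleR:
  assumes "symmetric_convex_body n K" "x \<in> K" "0 \<le> t" "t \<le> 1"
  shows "t *\<^sub>R x \<in> K"
proof -
  \<comment> \<open>Writing \<open>t x\<close> as a convex combination of \<open>x\<close> and
    \<open>- x\<close> avoids first showing that \<open>0\<close> lies in \<open>K\<close>.\<close>
  have "((1 + t) / 2) *\<^sub>R x + ((1 - t) / 2) *\<^sub>R (- x) \<in> K"
    using assms by (intro convexD body_uminus) (auto simp: symmetric_convex_body_def field_simps)
  also have "((1 + t) / 2) *\<^sub>R x + ((1 - t) / 2) *\<^sub>R (- x) = t *\<^sub>R x"
    by (simp add: fun_eq_iff field_simps)
  finally show ?thesis .
qed

section \<open>Points of the doubled body and of its projections\<close>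

text \<open>Two points of \<open>2K\<close> that are congruent modulo 4 differ by four times a lattice point of \<open>K\<close>.\<close>

lemma card_double_body_le:
  assumes K: "symmetric_convex_body n K"
  shows "finite {z \<in> Zn n. (1/2) *\<^sub>R z \<in> K}"
    and "card {z \<in> Zn n. (1/2) *\<^sub>R z \<in> K} \<le> 4 ^ n * card (K \<inter> Zn n)"
proof -
  let ?D = "{z \<in> Zn n. (1/2) *\<^sub>R z \<in> K}"
  let ?f = "\<lambda>x. restrict (\<lambda>i. \<lfloor>x i\<rfloor> mod 4) {..<n}"
  let ?R = "PiE {..<n} (\<lambda>_. {0..<4::int})"
  obtain B where B: "\<And>x i. x \<in> K \<Longrightarrow> \<bar>x i\<bar> \<le> B" using body_coordinates_bounded[OF K] by blast
  show fin: "finite ?D"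
  proof (rule finite_subset[OF _ finite_Zn_box[of n "2 * B"]])
    have "\<bar>z i\<bar> \<le> 2 * B" if "(1/2) *\<^sub>R z \<in> K" for z i
      using B[OF that, of i] by simp
    then show "?D \<subseteq> {x \<in> Zn n. \<forall>i<n. \<bar>x i\<bar> \<le> 2 * B}" by blast
  qed
  have "?D \<subseteq> (\<Union>r\<in>?R. {z \<in> ?D. ?f z = r})"
    by auto
  then have "card ?D \<le> card (\<Union>r\<in>?R. {z \<in> ?D. ?f z = r})"
    by (intro card_mono finite_UN_I finite_PiE finite_subset[OF _ fin]) auto
  also have "\<dots> \<le> (\<Sum>r\<in>?R. card {z \<in> ?D. ?f z = r})"
    by (intro card_UN_le finite_PiE) auto
  also have "\<dots> \<le> (\<Sum>r\<in>?R. card (K \<inter> Zn n))"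
  proof (rule sum_mono)
    fix r
    show "card {z \<in> ?D. ?f z = r} \<le> card (K \<inter> Zn n)"
    proof (cases "{z \<in> ?D. ?f z = r} = {}")
      case False
      then obtain a where a: "a \<in> ?D" "?f a = r" by blast
      show ?thesis
      \<comment> \<open>With a fixed representative \<open>a\<close>, each residue class is mapped
        injectively into the lattice points of \<open>K\<close>. Membership in \<open>K\<close>
        holds because a quarter of \<open>z - a\<close> is the midpoint of \<open>z/2\<close> and
        \<open>- a/2\<close>.\<close>
      proof (rule card_inj_on_le[of "\<lambda>z. (1/4) *\<^sub>R (z - a)"])
        show "inj_on (\<lambda>z. (1/4) *\<^sub>R (z - a)) {z \<in> ?D. ?f z = r}"
          by (auto simp: inj_on_def)
        show "(\<lambda>z. (1/4) *\<^sub>R (z - a)) ` {z \<in> ?D. ?f z = r} \<subseteq> K \<inter> Zn n"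
        proof (intro image_subsetI IntI)
          fix z assume z: "z \<in> {z \<in> ?D. ?f z = r}"
          have "(1/2) *\<^sub>R ((1/2) *\<^sub>R z + - ((1/2) *\<^sub>R a)) \<in> K"
            using z a by (intro body_midpoint[OF K] body_uminus[OF K]) auto
          also have "(1/2) *\<^sub>R ((1/2) *\<^sub>R z + - ((1/2) *\<^sub>R a)) = (1/4) *\<^sub>R (z - a)"
            by (simp add: fun_eq_iff field_simps)
          finally show "(1/4) *\<^sub>R (z - a) \<in> K" .
          have "(z i - a i) / 4 \<in> \<int>" for i
          proof (cases "i < n")
            case True
            have "?f z i = ?f a i" using z a by simp
            with True have "\<lfloor>z i\<rfloor> mod 4 = \<lfloor>a i\<rfloor> mod 4" by simp
            then obtain k where k: "\<lfloor>z i\<rfloor> - \<lfloor>a i\<rfloor> = 4 * k"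
              by (metis dvdE mod_eq_dvd_iff)
            have "z i = of_int \<lfloor>z i\<rfloor>" "a i = of_int \<lfloor>a i\<rfloor>"
              using z a by (auto simp: Zn_def elim!: Ints_cases)
            then have "z i - a i = of_int (4 * k)"
              by (metis k of_int_diff)
            then show ?thesis by simp
          next
            case False
            then show ?thesis using z a by (simp add: Zn_def Rn_def)
          qed
          then show "(1/4) *\<^sub>R (z - a) \<in> Zn n"
            using z a by (simp add: Zn_def Rn_def)
        qed
      qed (rule finite_body_Zn[OF K])
    next
      case True
      then show ?thesis unfolding True by simp
    qed
  qed
  also have "\<dots> = 4 ^ n * card (K \<inter> Zn n)"
    by (simp add: card_PiE)
  finally show "card ?D \<le> 4 ^ n * card (K \<inter> Zn n)" .
qed

text \<open>Each lattice point of the projection lifts to \<open>N\<close> lattice points of \<open>2K\<close>: above a point \<open>x\<close> of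
  \<open>K\<close>, the segment from \<open>x\<close> to \<open>x + N v\<close> lies in \<open>K + K\<close>.\<close>

lemma num_points_proj_le:
  assumes K: "symmetric_convex_body n K" and v: "v \<in> Zn n" "v \<noteq> 0"
    and N: "real N *\<^sub>R v \<in> K"
  shows "num_points (proj_perp n v ` Zn n) (proj_perp n v ` K) * N \<le> 4 ^ n * card (K \<inter> Zn n)"
proof -
  let ?P = "proj_perp n v ` K \<inter> proj_perp n v ` Zn n"
  let ?D = "{z \<in> Zn n. (1/2) *\<^sub>R z \<in> K}"
  have vv: "ip n v v \<noteq> 0"
    using ip_self_eq_0[of v n] v by (auto simp: Zn_def)
  have proj: "proj_perp n v (z + r *\<^sub>R v) = proj_perp n v z" for z r
    using vv by (simp add: proj_perp_def ip_def fun_eq_iff sum.distrib distrib_right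
      add_divide_distrib mult.assoc flip: sum_distrib_left)
  have "\<forall>y\<in>?P. \<exists>z. proj_perp n v z = y \<and> (\<forall>k\<in>{1..N}. z + real k *\<^sub>R v \<in> ?D)"
  proof
    fix y assume y: "y \<in> ?P"
    obtain x z where x: "x \<in> K" "y = proj_perp n v x" and z: "z \<in> Zn n" "y = proj_perp n v z"
      using y by blast
    \<comment> \<open>The points \<open>x\<close> and \<open>z\<close> have the same projection, so
      they differ by the multiple \<open>t v\<close>.\<close>
    define t where "t = (ip n x v - ip n z v) / ip n v v"
    have xz: "x = z + t *\<^sub>R v"
      using x(2) z(2) by (auto simp: t_def proj_perp_def fun_eq_iff algebra_simps diff_divide_distrib)
    \<comment> \<open>Rounding \<open>t\<close> down moves \<open>z\<close> along its fibre until
      \<open>x = z' + frac t v\<close> with \<open>0 \<le> frac t < 1\<close>.\<close>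
    define z' where "z' = z + of_int \<lfloor>t\<rfloor> *\<^sub>R v"
    have z': "z' \<in> Zn n" unfolding z'_def using z v by (intro Zn_add Zn_scaleR_of_int)
    have "z' + real k *\<^sub>R v \<in> ?D" if k: "k \<in> {1..N}" for k
    proof -
      \<comment> \<open>Solves \<open>x + s N v = z' + k v\<close>. Since
        \<open>frac t < 1 \<le> k \<le> N\<close>, the value lies in \<open>[0, 1]\<close>;
        \<open>k = 0\<close> could make it negative, so the lifts are indexed from 1.\<close>
      define s where "s = (real k - frac t) / real N"
      have "1 \<le> real k" "real k \<le> real N" using k by auto
      with frac_lt_1[of t] frac_ge_0[of t] have "0 \<le> real k - frac t" "real k - frac t \<le> real N"
        by linarith+
      with k have s: "0 \<le> s" "s \<le> 1" by (simp_all add: s_def)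
      have "(1/2) *\<^sub>R (x + s *\<^sub>R real N *\<^sub>R v) \<in> K"
        using body_midpoint[OF K x(1) body_scaleR[OF K N s]] .
      moreover have "x + s *\<^sub>R real N *\<^sub>R v = z' + real k *\<^sub>R v"
      proof -
        have "s * real N = real k - frac t" using k by (simp add: s_def)
        then have "s *\<^sub>R real N *\<^sub>R v = (real k - frac t) *\<^sub>R v" by (simp only: scaleR_scaleR)
        then show ?thesis by (simp add: xz z'_def frac_def fun_eq_iff algebra_simps)
      qed
      moreover have "z' + of_int (int k) *\<^sub>R v \<in> Zn n"
        using z' v by (intro Zn_add Zn_scaleR_of_int)
      ultimately show ?thesis by simp
    qed
    moreover have "proj_perp n v z' = y" using z(2) proj by (simp add: z'_def)
    ultimately show "\<exists>z. proj_perp n v z = y \<and> (\<forall>k\<in>{1..N}. z + real k *\<^sub>R v \<in> ?D)" by blast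
  qed
  from bchoice[OF this] obtain g where
    g: "\<forall>y\<in>?P. proj_perp n v (g y) = y \<and> (\<forall>k\<in>{1..N}. g y + real k *\<^sub>R v \<in> ?D)" ..
  have "card (?P \<times> {1..N}) \<le> card ?D"
  proof (rule card_inj_on_le[of "\<lambda>(y, k). g y + real k *\<^sub>R v"])
    show "inj_on (\<lambda>(y, k). g y + real k *\<^sub>R v) (?P \<times> {1..N})"
    proof (rule inj_onI)
      fix p p' assume "p \<in> ?P \<times> {1..N}" "p' \<in> ?P \<times> {1..N}"
        and "(\<lambda>(y, k). g y + real k *\<^sub>R v) p = (\<lambda>(y, k). g y + real k *\<^sub>R v) p'"
      then obtain y k y' k' where p: "p = (y, k)" "p' = (y', k')" and y: "y \<in> ?P" "y' \<in> ?P"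
        and eq: "g y + real k *\<^sub>R v = g y' + real k' *\<^sub>R v"
        by (cases p; cases p') (simp only: mem_Sigma_iff prod.case; blast)
      \<comment> \<open>Projecting removes the multiples of \<open>v\<close> and recovers
        \<open>y\<close>; then \<open>v \<noteq> 0\<close> recovers \<open>k\<close>.\<close>
      have "proj_perp n v (g y) = proj_perp n v (g y')"
        using arg_cong[OF eq, of "proj_perp n v"] by (simp only: proj)
      moreover have "proj_perp n v (g y) = y" "proj_perp n v (g y') = y'" using g y by blast+
      ultimately have "y = y'" by simp
      with eq v(2) have "k = k'" by simp
      with \<open>y = y'\<close> p show "p = p'" by simp
    qed
    show "(\<lambda>(y, k). g y + real k *\<^sub>R v) ` (?P \<times> {1..N}) \<subseteq> ?D"
      using g by (intro image_subsetI) (simp only: case_prod_unfold mem_Times_iff; blast)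
  qed (rule card_double_body_le(1)[OF K])
  also have "card (?P \<times> {1..N}) = card ?P * N" by (simp add: card_cartesian_product)
  also have "card ?D \<le> 4 ^ n * card (K \<inter> Zn n)" by (rule card_double_body_le(2)[OF K])
  finally show ?thesis by (simp only: num_points_def)
qed

section \<open>Lattice bases adapted to a flag\<close>

lemma scaleR_mem_span_iff:
  fixes x :: "'a::real_vector"
  assumes "c \<noteq> 0"
  shows "c *\<^sub>R x \<in> span S \<longleftrightarrow> x \<in> span S"
  using span_scale[of x S c] span_scale[of "c *\<^sub>R x" S "inverse c"] assms by auto

lemma span_image_lessThan:
  assumes "x \<in> span (v ` {..<k::nat})"
  shows "\<exists>a. x = (\<Sum>l<k. a l *\<^sub>R v l)"
  using assms
proof (induction k arbitrary: x)
  case (Suc k)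
  then obtain c where "x - c *\<^sub>R v k \<in> span (v ` {..<k})"
    by (auto simp: lessThan_Suc span_breakdown_eq)
  then obtain a where a: "x - c *\<^sub>R v k = (\<Sum>l<k. a l *\<^sub>R v l)" using Suc.IH by blast
  have "x = (\<Sum>l<Suc k. (a(k := c)) l *\<^sub>R v l)"
    using a by (simp add: algebra_simps)
  then show ?case by blast
qed simp

text \<open>Modulo the span of the predecessors, a lattice vector in the span of the first
  \<open>k + 1\<close> vectors is determined by its coefficient at \<open>v k\<close>. These
  coefficients form a discrete subgroup of the reals; \<open>b\<close> realizes its least positive
  element \<open>d\<close>, which generates it.\<close>

lemma lattice_flag_generator:
  fixes v :: "nat \<Rightarrow> nat \<Rightarrow> real"
  assumes v: "\<And>l. l \<le> k \<Longrightarrow> v l \<in> Zn n" and nin: "v k \<notin> span (v ` {..<k})"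
  shows "\<exists>b\<in>Zn n. b \<in> span (v ` {..<Suc k}) \<and> b \<notin> span (v ` {..<k}) \<and>
    (\<forall>h\<in>Zn n \<inter> span (v ` {..<Suc k}). \<exists>m::int. h - of_int m *\<^sub>R b \<in> span (v ` {..<k}))"
proof -
  let ?W = "span (v ` {..<k})"
  define C where "C = {c. \<exists>h\<in>Zn n. h - c *\<^sub>R v k \<in> ?W}"
  define B where "B = (\<Sum>l<Suc k. \<Sum>i<n. \<bar>v l i\<bar>)"
  define F where "F = {x \<in> Zn n. \<forall>i<n. \<bar>x i\<bar> \<le> B}"
  have uniq: "c = c'" if "h - c *\<^sub>R v k \<in> ?W" "h - c' *\<^sub>R v k \<in> ?W" for h c c'
  proof (rule ccontr)
    assume "c \<noteq> c'"
    have "(h - c *\<^sub>R v k) - (h - c' *\<^sub>R v k) \<in> ?W" using that by (rule span_diff)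
    then have "(c' - c) *\<^sub>R v k \<in> ?W" by (simp add: algebra_simps)
    with \<open>c \<noteq> c'\<close> nin show False by (simp add: scaleR_mem_span_iff)
  qed
  \<comment> \<open>Discreteness: subtracting integer multiples of the predecessors leaves
    fractional coefficients at them and keeps the coefficient \<open>c\<close>. So every
    \<open>c\<close> in \<open>(0, 1]\<close> comes from a lattice vector in one fixed box.\<close>
  have "C \<inter> {0<..1} \<subseteq> (\<Union>h\<in>F. {c. h - c *\<^sub>R v k \<in> ?W})"
  proof
    fix c assume "c \<in> C \<inter> {0<..1}"
    then obtain h where c: "0 < c" "c \<le> 1" and h: "h \<in> Zn n" "h - c *\<^sub>R v k \<in> ?W"
      by (auto simp: C_def)
    obtain a where a: "h - c *\<^sub>R v k = (\<Sum>l<k. a l *\<^sub>R v l)"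
      using span_image_lessThan[OF h(2)] by blast
    define h' where "h' = h - (\<Sum>l<k. of_int \<lfloor>a l\<rfloor> *\<^sub>R v l)"
    have h'_eq: "h' = c *\<^sub>R v k + (\<Sum>l<k. frac (a l) *\<^sub>R v l)"
      using a by (simp add: h'_def frac_def algebra_simps sum_subtractf)
    have "h' \<in> Zn n" unfolding h'_def
      using h v by (intro Zn_diff Zn_sum_scaleR_of_int) auto
    moreover have "\<bar>h' i\<bar> \<le> B" if "i < n" for i
    proof -
      have "\<bar>h' i\<bar> \<le> \<bar>c * v k i\<bar> + \<bar>\<Sum>l<k. frac (a l) * v l i\<bar>"
        by (simp add: h'_eq sum_fun_apply)
      also have "\<dots> \<le> \<bar>v k i\<bar> + (\<Sum>l<k. \<bar>v l i\<bar>)"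
      proof (intro add_mono order_trans[OF sum_abs] sum_mono)
        show "\<bar>c * v k i\<bar> \<le> \<bar>v k i\<bar>"
          using c by (simp add: abs_mult mult_left_le_one_le)
        show "\<bar>frac (a l) * v l i\<bar> \<le> \<bar>v l i\<bar>" for l
          using frac_lt_1[of "a l"] by (simp add: abs_mult mult_left_le_one_le)
      qed
      also have "\<dots> = (\<Sum>l<Suc k. \<bar>v l i\<bar>)" by simp
      also have "\<dots> \<le> B"
        unfolding B_def using that by (intro sum_mono member_le_sum) auto
      finally show ?thesis .
    qed
    moreover have "h' - c *\<^sub>R v k \<in> ?W"
      unfolding h'_eq add_diff_cancel_left' by (intro span_sum span_scale span_base imageI)
    ultimately show "c \<in> (\<Union>h\<in>F. {c. h - c *\<^sub>R v k \<in> ?W})" by (auto simp: F_def)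
  qed
  moreover have "finite {c. h - c *\<^sub>R v k \<in> ?W}" for h
  proof (cases "{c. h - c *\<^sub>R v k \<in> ?W} = {}")
    case False
    then obtain c where "h - c *\<^sub>R v k \<in> ?W" by blast
    then have "{c. h - c *\<^sub>R v k \<in> ?W} \<subseteq> {c}" using uniq by blast
    then show ?thesis using finite_subset by blast
  qed simp
  ultimately have fin: "finite (C \<inter> {0<..1})"
    using finite_Zn_box by (auto intro: finite_subset simp: F_def)
  have "1 \<in> C" using v by (force simp: C_def span_zero)
  then have ne: "C \<inter> {0<..1} \<noteq> {}" by auto
  define d where "d = Min (C \<inter> {0<..1})"
  have d: "d \<in> C" "0 < d" "d \<le> 1" using Min_in[OF fin ne] by (auto simp: d_def)
  have dmin: "d \<le> c" if "c \<in> C" "0 < c" for c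
    using Min_le[OF fin, of c] that d(3) by (cases "c \<le> 1") (auto simp: d_def)
  obtain b where b: "b \<in> Zn n" "b - d *\<^sub>R v k \<in> ?W" using d(1) by (auto simp: C_def)
  have "b \<in> span (v ` {..<Suc k})"
    using b(2) by (auto simp: lessThan_Suc span_breakdown_eq)
  moreover have "b \<notin> ?W" using uniq[of b d 0] b(2) d(2) by auto
  moreover have "\<exists>m::int. h - of_int m *\<^sub>R b \<in> ?W" if h: "h \<in> Zn n \<inter> span (v ` {..<Suc k})" for h
  proof -
    obtain c where c: "h - c *\<^sub>R v k \<in> ?W"
      using h by (auto simp: lessThan_Suc span_breakdown_eq)
    \<comment> \<open>Division with remainder by \<open>d\<close>: the remainder
      \<open>c - m d\<close> belongs to \<open>C\<close> and lies in \<open>[0, d)\<close>, so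
      minimality of \<open>d\<close> forces it to be 0.\<close>
    define m where "m = \<lfloor>c / d\<rfloor>"
    have "(h - c *\<^sub>R v k) - of_int m *\<^sub>R (b - d *\<^sub>R v k) \<in> ?W"
      by (rule span_diff[OF c span_scale[OF b(2)]])
    then have W: "(h - of_int m *\<^sub>R b) - (c - of_int m * d) *\<^sub>R v k \<in> ?W"
      by (simp add: algebra_simps)
    have "h - of_int m *\<^sub>R b \<in> Zn n" using h b(1) by (intro Zn_diff Zn_scaleR_of_int) auto
    with W have "c - of_int m * d \<in> C" by (auto simp: C_def)
    moreover have "c - of_int m * d < d" "0 \<le> c - of_int m * d"
      using floor_divide_lower[OF d(2), of c] floor_divide_upper[OF d(2), of c]
      by (simp_all add: m_def algebra_simps)
    ultimately have "c - of_int m * d = 0" using dmin[of "c - of_int m * d"] by linarith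
    with W have "h - of_int m *\<^sub>R b \<in> ?W" by simp
    then show ?thesis by blast
  qed
  ultimately show ?thesis using b(1) by blast
qed

text \<open>The generators of the successive flag steps form a basis: subtracting the right multiple
  of the top one pushes a lattice vector one step down the flag, and induction finishes.\<close>

lemma adapted_lattice_basis:
  fixes v :: "nat \<Rightarrow> nat \<Rightarrow> real"
  assumes v: "\<And>l. l < n \<Longrightarrow> v l \<in> Zn n"
    and nin: "\<And>l. l < n \<Longrightarrow> v l \<notin> span (v ` {..<l})"
  shows "\<exists>b. (\<forall>k<n. b k \<in> Zn n \<and> b k \<in> span (v ` {..<Suc k}) \<and> b k \<notin> span (v ` {..<k})) \<and>
    (\<forall>h\<in>Zn n \<inter> span (v ` {..<n}). \<exists>z::nat \<Rightarrow> int. h = (\<Sum>k<n. of_int (z k) *\<^sub>R b k))"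
proof -
  define Q where "Q k b \<longleftrightarrow> b \<in> Zn n \<and> b \<in> span (v ` {..<Suc k}) \<and> b \<notin> span (v ` {..<k}) \<and>
    (\<forall>h\<in>Zn n \<inter> span (v ` {..<Suc k}). \<exists>m::int. h - of_int m *\<^sub>R b \<in> span (v ` {..<k}))" for k b
  have "\<exists>b. Q k b" if "k < n" for k
    unfolding Q_def Bex_def[symmetric]
    by (rule lattice_flag_generator) (use v nin that in auto)
  then obtain b where Q: "\<And>k. k < n \<Longrightarrow> Q k (b k)" by metis
  then have b: "\<And>k. k < n \<Longrightarrow> b k \<in> Zn n" "\<And>k. k < n \<Longrightarrow> b k \<in> span (v ` {..<Suc k})"
      "\<And>k. k < n \<Longrightarrow> b k \<notin> span (v ` {..<k})"
    unfolding Q_def by blast+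
  have red: "\<exists>m::int. h - of_int m *\<^sub>R b k \<in> span (v ` {..<k})"
    if "k < n" "h \<in> Zn n" "h \<in> span (v ` {..<Suc k})" for k h
    using Q[OF that(1)] that(2,3) unfolding Q_def by blast
  have "\<exists>z::nat \<Rightarrow> int. h = (\<Sum>k<i. of_int (z k) *\<^sub>R b k)"
    if "i \<le> n" "h \<in> Zn n \<inter> span (v ` {..<i})" for h i
    using that
  proof (induction i arbitrary: h)
    case (Suc i)
    then obtain m :: int where m: "h - of_int m *\<^sub>R b i \<in> span (v ` {..<i})"
      using red[of i h] by auto
    have "h - of_int m *\<^sub>R b i \<in> Zn n"
      using Suc.prems b(1) by (intro Zn_diff Zn_scaleR_of_int) auto
    then obtain z :: "nat \<Rightarrow> int" where "h - of_int m *\<^sub>R b i = (\<Sum>k<i. of_int (z k) *\<^sub>R b k)"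
      using Suc.IH[OF _ IntI[OF _ m]] Suc.prems(1) by (meson Suc_leD)
    then have "h = (\<Sum>k<Suc i. of_int ((z(i := m)) k) *\<^sub>R b k)"
      by (simp add: algebra_simps)
    then show ?case by blast
  qed simp
  then show ?thesis using b by blast
qed

section \<open>Upper bound for the number of lattice points by residues in an adapted basis\<close>

text \<open>If two lattice points of \<open>K\<close> have the same coordinates modulo \<open>2 ^ Suc (e k)\<close> in an adapted
  basis, their difference is \<open>2 ^ Suc (e k)\<close> times a lattice vector \<open>w\<close>, where \<open>k\<close> is the last
  coordinate in which they differ; by symmetry \<open>2 ^ e k w \<in> K\<close>, so \<open>w\<close> is too short.\<close>

lemma card_body_le_prod:
  fixes v :: "nat \<Rightarrow> nat \<Rightarrow> real" and e :: "nat \<Rightarrow> nat"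
  assumes K: "symmetric_convex_body n K"
    and v: "\<And>l. l < n \<Longrightarrow> v l \<in> Zn n"
    and nin: "\<And>l. l < n \<Longrightarrow> v l \<notin> span (v ` {..<l})"
    and KS: "K \<inter> Zn n \<subseteq> span (v ` {..<n})"
    and e: "\<And>k l. k \<le> l \<Longrightarrow> l < n \<Longrightarrow> e l \<le> e k"
    and short: "\<And>k w. k < n \<Longrightarrow> w \<in> Zn n \<Longrightarrow> 2 ^ e k *\<^sub>R w \<in> K \<Longrightarrow> w \<in> span (v ` {..<k})"
  shows "card (K \<inter> Zn n) \<le> (\<Prod>k<n. 2 ^ Suc (e k))"
proof -
  let ?q = "\<lambda>k. 2 ^ Suc (e k) :: int"
  obtain b where b: "\<And>k. k < n \<Longrightarrow> b k \<in> Zn n"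
      "\<And>k. k < n \<Longrightarrow> b k \<in> span (v ` {..<Suc k})" "\<And>k. k < n \<Longrightarrow> b k \<notin> span (v ` {..<k})"
    and ex: "\<And>h. h \<in> Zn n \<inter> span (v ` {..<n}) \<Longrightarrow> \<exists>z::nat \<Rightarrow> int. h = (\<Sum>k<n. of_int (z k) *\<^sub>R b k)"
    using adapted_lattice_basis[of n v, OF v nin] by blast
  have "\<forall>h\<in>K \<inter> Zn n. \<exists>z::nat \<Rightarrow> int. h = (\<Sum>k<n. of_int (z k) *\<^sub>R b k)"
    using ex KS by blast
  from bchoice[OF this] obtain z :: "(nat \<Rightarrow> real) \<Rightarrow> nat \<Rightarrow> int" where
    z: "\<And>h. h \<in> K \<inter> Zn n \<Longrightarrow> h = (\<Sum>k<n. of_int (z h k) *\<^sub>R b k)" by blast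
  let ?f = "\<lambda>h. restrict (\<lambda>k. z h k mod ?q k) {..<n}"
  have "card (K \<inter> Zn n) \<le> card (PiE {..<n} (\<lambda>k. {0..<?q k}))"
  proof (rule card_inj_on_le[of ?f])
    show "?f ` (K \<inter> Zn n) \<subseteq> PiE {..<n} (\<lambda>k. {0..<?q k})"
      by (intro image_subsetI restrict_PiE_iff[THEN iffD2]) simp
    show "inj_on ?f (K \<inter> Zn n)"
    proof (rule inj_onI, rule ccontr)
      fix x y assume x: "x \<in> K \<inter> Zn n" and y: "y \<in> K \<inter> Zn n" and eq: "?f x = ?f y" and "x \<noteq> y"
      have "\<exists>d. z x k - z y k = ?q k * d" if "k < n" for k
        using fun_cong[OF eq, of k] that by (simp add: mod_eq_dvd_iff dvd_def)
      then obtain d where d: "\<And>k. k < n \<Longrightarrow> z x k - z y k = ?q k * d k" by metis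
      have "x - y = (\<Sum>k<n. of_int (z x k) *\<^sub>R b k) - (\<Sum>k<n. of_int (z y k) *\<^sub>R b k)"
        using z[OF x] z[OF y] by simp
      also have "\<dots> = (\<Sum>k<n. of_int (z x k - z y k) *\<^sub>R b k)"
        by (simp add: algebra_simps sum_subtractf)
      also have "\<dots> = (\<Sum>k<n. of_int (?q k * d k) *\<^sub>R b k)"
        using d by (intro sum.cong) auto
      finally have xy: "x - y = (\<Sum>k<n. of_int (?q k * d k) *\<^sub>R b k)" .
      define k where "k = Max {k. k < n \<and> d k \<noteq> 0}"
      have "{k. k < n \<and> d k \<noteq> 0} \<noteq> {}"
      proof
        assume "{k. k < n \<and> d k \<noteq> 0} = {}"
        then have "x - y = 0" unfolding xy by (intro sum.neutral) auto
        with \<open>x \<noteq> y\<close> show False by simp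
      qed
      then have "k \<in> {k. k < n \<and> d k \<noteq> 0}"
        unfolding k_def by (intro Max_in) auto
      then have k: "k < n" "d k \<noteq> 0" by auto
      have last: "d l = 0" if "k < l" "l < n" for l
        using Max_ge[of "{k. k < n \<and> d k \<noteq> 0}" l] that by (fastforce simp: k_def)
      \<comment> \<open>Since \<open>e k \<le> e l\<close> for \<open>l \<le> k\<close>, the modulus
        at \<open>k\<close> divides all moduli at smaller indices. Hence it can be factored out of
        the whole difference, leaving integer coefficients; no subtraction of exponents is truncated
        here.\<close>
      define w where "w = (\<Sum>l<Suc k. of_int (2 ^ (e l - e k) * d l) *\<^sub>R b l)"
      have "x - y = (\<Sum>l<Suc k. of_int (?q l * d l) *\<^sub>R b l)"
        unfolding xy using k(1) last by (intro sum.mono_neutral_right) (auto simp: not_less_eq)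
      also have "\<dots> = (\<Sum>l<Suc k. 2 ^ Suc (e k) *\<^sub>R of_int (2 ^ (e l - e k) * d l) *\<^sub>R b l)"
      proof (rule sum.cong)
        fix l assume "l \<in> {..<Suc k}"
        then have "e k \<le> e l" using e k(1) by simp
        then have "?q l = 2 ^ Suc (e k) * 2 ^ (e l - e k)" by (simp flip: power_add)
        then show "of_int (?q l * d l) *\<^sub>R b l = 2 ^ Suc (e k) *\<^sub>R of_int (2 ^ (e l - e k) * d l) *\<^sub>R b l"
          by simp
      qed simp
      also have "\<dots> = 2 ^ Suc (e k) *\<^sub>R w" by (simp only: w_def scaleR_sum_right)
      finally have "2 ^ e k *\<^sub>R w = (1/2) *\<^sub>R (x + - y)" by simp
      moreover have "(1/2) *\<^sub>R (x + - y) \<in> K"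
        using x y by (intro body_midpoint[OF K] body_uminus[OF K]) auto
      moreover have "w \<in> Zn n"
        unfolding w_def using b(1) k(1) by (intro Zn_sum_scaleR_of_int) auto
      ultimately have w: "w \<in> span (v ` {..<k})" using short[OF k(1)] by simp
      \<comment> \<open>The coefficient of \<open>b k\<close> in \<open>w\<close> is
        \<open>d k\<close>. Removing the lower terms would put a nonzero multiple of
        \<open>b k\<close> into the span of the first \<open>k\<close> vectors.\<close>
      have "(\<Sum>l<k. of_int (2 ^ (e l - e k) * d l) *\<^sub>R b l) \<in> span (v ` {..<k})"
      proof (intro span_sum span_scale)
        fix l assume "l \<in> {..<k}"
        then have "span (v ` {..<Suc l}) \<subseteq> span (v ` {..<k})"
          by (intro span_mono image_mono) auto
        then show "b l \<in> span (v ` {..<k})" using b(2)[of l] k(1) \<open>l \<in> {..<k}\<close> by auto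
      qed
      from span_diff[OF w this] have "of_int (d k) *\<^sub>R b k \<in> span (v ` {..<k})"
        by (simp add: w_def)
      with k b(3) show False by (simp add: scaleR_mem_span_iff)
    qed
  qed (auto intro: finite_PiE)
  also have "\<dots> = (\<Prod>k<n. 2 ^ Suc (e k))"
    by (simp add: card_PiE nat_power_eq nat_mult_distrib)
  finally show ?thesis .
qed

section \<open>Flags of length \<open>n\<close> span the whole space\<close>

lemma Rn_subset_span: "Rn n \<subseteq> span ((\<lambda>i j. if j = i then 1 else 0) ` {..<n})"
proof
  fix x assume x: "x \<in> Rn n"
  have "x = (\<Sum>i<n. x i *\<^sub>R (\<lambda>j. if j = i then 1 else 0))"
  proof
    fix j
    show "x j = (\<Sum>i<n. x i *\<^sub>R (\<lambda>j. if j = i then 1 else 0)) j"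
      using x by (cases "j < n") (auto simp: sum_fun_apply Rn_def if_distrib cong: if_cong)
  qed
  also have "\<dots> \<in> span ((\<lambda>i j. if j = i then 1 else 0) ` {..<n})"
    by (intro span_sum span_scale span_base imageI)
  finally show "x \<in> span ((\<lambda>i j. if j = i then 1 else 0) ` {..<n})" .
qed

lemma independent_image_lessThan:
  fixes v :: "nat \<Rightarrow> 'a::real_vector"
  assumes "\<And>l. l < n \<Longrightarrow> v l \<notin> span (v ` {..<l})"
  shows "independent (v ` {..<n})" and "inj_on v {..<n}"
proof -
  have "independent (v ` {..<n}) \<and> inj_on v {..<n}"
    using assms
  proof (induction n)
    case (Suc n)
    then have IH: "independent (v ` {..<n})" "inj_on v {..<n}" and nin: "v n \<notin> span (v ` {..<n})"
      by auto
    have "v n \<notin> v ` {..<n}" using nin span_base[of "v n" "v ` {..<n}"] by blast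
    then have "v n \<notin> v ` ({..<n} - {n})" by blast
    with IH nin show ?case
      unfolding lessThan_Suc image_insert by (simp only: inj_on_insert independent_insertI simp_thms)
  qed (simp add: independent_empty)
  then show "independent (v ` {..<n})" "inj_on v {..<n}" by auto
qed

text \<open>A vector outside the span would yield \<open>n + 1\<close> independent vectors in the
  span of the \<open>n\<close> unit vectors.\<close>

lemma Rn_subset_span_of_flag:
  fixes v :: "nat \<Rightarrow> nat \<Rightarrow> real"
  assumes v: "\<And>l. l < n \<Longrightarrow> v l \<in> Rn n"
    and nin: "\<And>l. l < n \<Longrightarrow> v l \<notin> span (v ` {..<l})"
  shows "Rn n \<subseteq> span (v ` {..<n})"
proof (rule subsetI, rule ccontr)
  fix u assume u: "u \<in> Rn n" "u \<notin> span (v ` {..<n})"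
  let ?E = "(\<lambda>i j. if j = i then 1 else 0::real) ` {..<n}"
  have ind: "independent (v ` {..<n})" and inj: "inj_on v {..<n}"
    using independent_image_lessThan[OF nin] by auto
  have "independent (insert u (v ` {..<n}))"
    using ind u(2) by (simp add: independent_insertI)
  moreover have "insert u (v ` {..<n}) \<subseteq> span ?E"
    using u(1) v Rn_subset_span[of n] by blast
  ultimately have "card (insert u (v ` {..<n})) \<le> card ?E"
    by (intro conjunct2[OF independent_span_bound]) auto
  also have "\<dots> \<le> n" using card_image_le[of "{..<n}"] by (metis card_lessThan finite_lessThan)
  also have "card (insert u (v ` {..<n})) = Suc n"
    using u(2) inj span_base[of u "v ` {..<n}"] by (subst card_insert_disjoint) (auto simp: card_image)
  finally show False by simp
qed

section \<open>Largest multiples and the greedy choice\<close>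

text \<open>This is the number \<open>N(w)\<close>. \<open>GREATEST\<close> gives a genuine maximum
  for nonempty \<open>K\<close> and nonzero lattice vectors \<open>w\<close>; at
  \<open>w = 0\<close> the multiples in a nonempty \<open>K\<close> have no maximum.\<close>

definition max_multiple :: "(nat \<Rightarrow> real) set \<Rightarrow> (nat \<Rightarrow> real) \<Rightarrow> nat" where
  "max_multiple K w = (GREATEST k. real k *\<^sub>R w \<in> K)"

text \<open>A nonzero lattice vector has a coordinate of absolute value at least 1, so a coordinate
  bound for \<open>K\<close> also bounds \<open>k\<close>. The bound is uniform in \<open>w\<close>,
  which lets the greedy choice attain its maximum.\<close>

lemma multiples_in_body_bounded:
  assumes "symmetric_convex_body n K"
  shows "\<exists>B. \<forall>w\<in>Zn n - {0}. \<forall>k. real k *\<^sub>R w \<in> K \<longrightarrow> k \<le> B"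
proof -
  obtain C where C: "\<And>x i. x \<in> K \<Longrightarrow> \<bar>x i\<bar> \<le> C"
    using body_coordinates_bounded[OF assms] by blast
  have "k \<le> nat \<lceil>C\<rceil>" if w: "w \<in> Zn n - {0}" and k: "real k *\<^sub>R w \<in> K" for w k
  proof -
    obtain i where "w i \<noteq> 0" using w by (auto simp: fun_eq_iff)
    moreover have "w i \<in> \<int>" using w by (simp add: Zn_def)
    ultimately have "1 \<le> \<bar>w i\<bar>" by (simp add: Ints_nonzero_abs_ge1)
    then have "real k \<le> \<bar>real k * w i\<bar>" by (simp add: abs_mult mult_le_cancel_left1)
    also have "\<dots> \<le> C" using C[OF k, of i] by simp
    finally show ?thesis by linarith
  qed
  then show ?thesis by blast
qed

lemma max_multiple_mem:
  assumes K: "symmetric_convex_body n K" "K \<noteq> {}" and w: "w \<in> Zn n" "w \<noteq> 0"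
  shows "real (max_multiple K w) *\<^sub>R w \<in> K"
proof -
  obtain x where "x \<in> K" using K(2) by blast
  then have "0 *\<^sub>R x \<in> K" by (rule body_scaleR[OF K(1)]) auto
  then have zero: "real 0 *\<^sub>R w \<in> K" by simp
  obtain B where B: "\<And>k. real k *\<^sub>R w \<in> K \<Longrightarrow> k \<le> B"
    using multiples_in_body_bounded[OF K(1)] w by blast
  show ?thesis
    unfolding max_multiple_def
    by (rule GreatestI_nat[where P = "\<lambda>k. real k *\<^sub>R w \<in> K", OF zero B])
qed

lemma max_multiple_ge:
  assumes K: "symmetric_convex_body n K" and w: "w \<in> Zn n" "w \<noteq> 0" and k: "real k *\<^sub>R w \<in> K"
  shows "k \<le> max_multiple K w"
proof -
  obtain B where B: "\<And>k. real k *\<^sub>R w \<in> K \<Longrightarrow> k \<le> B"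
    using multiples_in_body_bounded[OF K] w by blast
  show ?thesis
    unfolding max_multiple_def
    by (rule Greatest_le_nat[where P = "\<lambda>k. real k *\<^sub>R w \<in> K", OF k B])
qed

text \<open>For \<open>l < n\<close> the dimension hypothesis provides a lattice point of
  \<open>K\<close> outside the span of the predecessors. It is a candidate with \<open>N\<close> at
  least 1, and the uniform bound on \<open>N\<close> makes a best candidate exist.\<close>

lemma greedy_flag:
  assumes K: "symmetric_convex_body n K" "K \<noteq> {}" and dim: "dim (K \<inter> Zn n) = n"
  shows "\<exists>v. \<forall>l<n. v l \<in> Zn n \<and> v l \<notin> span (v ` {..<l}) \<and> 1 \<le> max_multiple K (v l) \<and>
    (\<forall>w\<in>Zn n. w \<notin> span (v ` {..<l}) \<longrightarrow> max_multiple K w \<le> max_multiple K (v l))"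
proof -
  obtain B where B: "\<And>w k. w \<in> Zn n \<Longrightarrow> w \<noteq> 0 \<Longrightarrow> real k *\<^sub>R w \<in> K \<Longrightarrow> k \<le> B"
    using multiples_in_body_bounded[OF K(1)] by blast
  \<comment> \<open>Vacuous from \<open>n\<close> on, so that the recursive choice can run over all
    natural numbers.\<close>
  define P where "P f l r \<longleftrightarrow> (l < n \<longrightarrow> r \<in> Zn n \<and> r \<notin> span (f ` {..<l}) \<and> 1 \<le> max_multiple K r \<and>
    (\<forall>w\<in>Zn n. w \<notin> span (f ` {..<l}) \<longrightarrow> max_multiple K w \<le> max_multiple K r))"
    for f :: "nat \<Rightarrow> nat \<Rightarrow> real" and l r
  have "\<exists>v. \<forall>l. P v l (v l)"
  proof (rule dependent_wellorder_choice)
    fix r l and f g :: "nat \<Rightarrow> nat \<Rightarrow> real"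
    assume "\<And>y. y < l \<Longrightarrow> f y = g y"
    then have "f ` {..<l} = g ` {..<l}" by auto
    then show "P f l r = P g l r" by (simp add: P_def)
  next
    fix l and f :: "nat \<Rightarrow> nat \<Rightarrow> real"
    let ?Q = "\<lambda>w. w \<in> Zn n \<and> w \<notin> span (f ` {..<l})"
    show "\<exists>r. P f l r"
    proof (cases "l < n")
      case True
      have "\<not> K \<inter> Zn n \<subseteq> span (f ` {..<l})"
      proof
        assume "K \<inter> Zn n \<subseteq> span (f ` {..<l})"
        then have "dim (K \<inter> Zn n) \<le> card (f ` {..<l})" by (rule dim_le_card) simp
        also have "\<dots> \<le> l" using card_image_le[of "{..<l}" f] by simp
        finally show False using True dim by simp
      qed
      then obtain u where u: "u \<in> K" "?Q u" by blast
      have nz: "w \<noteq> 0" if "?Q w" for w using that span_zero[of "f ` {..<l}"] by metis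
      have bd: "\<forall>w. ?Q w \<longrightarrow> max_multiple K w < Suc B"
        using B nz max_multiple_mem[OF K] by (metis less_Suc_eq_le)
      have "\<exists>r. ?Q r \<and> (\<forall>w. ?Q w \<longrightarrow> max_multiple K w \<le> max_multiple K r)"
        by (rule ex_has_greatest_nat[OF u(2) bd])
      then obtain r where r: "?Q r" "\<And>w. ?Q w \<Longrightarrow> max_multiple K w \<le> max_multiple K r" by blast
      have "1 \<le> max_multiple K u"
        using u nz[OF u(2)] by (intro max_multiple_ge[OF K(1)]) simp_all
      also have "\<dots> \<le> max_multiple K r" using r(2) u(2) .
      finally show ?thesis using r unfolding P_def by blast
    qed (simp add: P_def)
  qed
  then show ?thesis unfolding P_def by blast
qed

section \<open>Taking roots and combining the two bounds\<close>

lemma root_bound: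
  fixes S P :: real
  assumes n: "n \<ge> 1" and S: "S > 0" and P: "0 \<le> P" and le: "P * S \<le> 4 ^ (n * n + n) * S ^ n"
  shows "S powr ((real n - 1) / real n) \<ge> (1/16) ^ n * P powr (1 / real n)"
proof -
  have "S ^ n = S powr (real n - 1) * S"
    using n S by (cases n) (simp_all add: powr_realpow)
  with le S have "P \<le> 4 ^ (n * n + n) * S powr (real n - 1)"
    by (metis mult.assoc mult_le_cancel_right_pos)
  then have "P powr (1 / real n) \<le> (4 ^ (n * n + n) * S powr (real n - 1)) powr (1 / real n)"
    using P by (intro powr_mono2) auto
  also have "\<dots> = (4 ^ (n * n + n)) powr (1 / real n) * S powr ((real n - 1) / real n)"
    by (simp add: powr_mult powr_powr)
  also have "(4 ^ (n * n + n)) powr (1 / real n) = (4::real) powr (real (n * n + n) / real n)"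
    by (simp add: powr_powr flip: powr_realpow)
  also have "real (n * n + n) / real n = real (Suc n)"
    using n by (simp add: field_simps)
  also have "(4::real) powr real (Suc n) = 4 ^ Suc n" by (rule powr_realpow) simp
  finally have "(1/16) ^ n * P powr (1 / real n)
      \<le> ((1/16) ^ n * 4 ^ Suc n) * S powr ((real n - 1) / real n)"
    by (simp add: mult.assoc)
  \<comment> \<open>The root has turned the constant into \<open>4 ^ (n + 1)\<close>, which is at
    most \<open>16 ^ n\<close> because \<open>n \<ge> 1\<close>; this is where \<open>1/16\<close>
    comes from.\<close>
  also have "\<dots> \<le> 1 * S powr ((real n - 1) / real n)"
  proof (rule mult_right_mono)
    have "(4::real) ^ Suc n \<le> 4 ^ (2 * n)" using n by (intro power_increasing) auto
    also have "\<dots> = 16 ^ n" by (simp add: power_mult)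
    finally show "(1/16) ^ n * 4 ^ Suc n \<le> (1::real)" by (simp add: power_divide)
  qed simp
  finally show ?thesis by simp
qed

theorem theorem1p6:
  shows "\<exists>c::real. c > 0 \<and>
    (\<forall>(n::nat) K. n \<ge> 1 \<longrightarrow> symmetric_convex_body n K \<longrightarrow> dim (K \<inter> Zn n) = n \<longrightarrow>
      (\<exists>v :: nat \<Rightarrow> nat \<Rightarrow> real.
        (\<forall>i\<in>{1..n}. v i \<in> Zn n) \<and>
        inj_on v {1..n} \<and> independent (v ` {1..n}) \<and>
        real (num_points (Zn n) K) powr ((real n - 1) / real n)
          \<ge> c ^ n * (\<Prod>i=1..n. real (num_points (proj_perp n (v i) ` Zn n)
                                              (proj_perp n (v i) ` K))) powr (1 / real n)))"
proof (intro exI[of _ "1/16"] conjI allI impI)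
  fix n K assume n: "n \<ge> (1::nat)" and K: "symmetric_convex_body n K" and dim: "dim (K \<inter> Zn n) = n"
  have KZ: "K \<inter> Zn n \<noteq> {}" using dim_le_card[of "K \<inter> Zn n" "{}"] n dim by auto
  then have ne: "K \<noteq> {}" by blast
  define S where "S = card (K \<inter> Zn n)"
  have S: "S > 0" using KZ finite_body_Zn[OF K] by (simp add: S_def card_gt_0_iff)
  let ?N = "max_multiple K"
  obtain v where v: "\<And>l. l < n \<Longrightarrow> v l \<in> Zn n"
    and nin: "\<And>l. l < n \<Longrightarrow> v l \<notin> span (v ` {..<l})"
    and greedy: "\<And>l w. l < n \<Longrightarrow> w \<in> Zn n \<Longrightarrow> w \<notin> span (v ` {..<l}) \<Longrightarrow> ?N w \<le> ?N (v l)"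
    and pos: "\<And>l. l < n \<Longrightarrow> 1 \<le> ?N (v l)"
    using greedy_flag[OF K ne dim] by blast
  have nz: "v l \<noteq> 0" if "l < n" for l using nin[OF that] span_zero[of "v ` {..<l}"] by metis
  \<comment> \<open>\<open>2 ^ e l\<close> is the least power of two exceeding
    \<open>N(v l)\<close>. Hence \<open>N < 2 ^ e l \<le> 2 N\<close>: the first inequality makes
    vectors \<open>w\<close> with \<open>2 ^ e l w\<close> in \<open>K\<close> too short, the second
    bounds the modulus \<open>2 ^ Suc (e l)\<close> by \<open>4 N\<close>.\<close>
  define e where "e l = Suc (floor_log (?N (v l)))" for l
  have "S \<le> (\<Prod>k<n. 2 ^ Suc (e k))"
    unfolding S_def
  proof (rule card_body_le_prod[OF K v nin])
    have "Rn n \<subseteq> span (v ` {..<n})"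
      using v nin by (intro Rn_subset_span_of_flag) (auto simp: Zn_def)
    then show "K \<inter> Zn n \<subseteq> span (v ` {..<n})" by (auto simp: Zn_def)
    show "e l \<le> e k" if "k \<le> l" "l < n" for k l
    proof -
      \<comment> \<open>The vector \<open>v l\<close> was already a candidate at the earlier stage
        \<open>k\<close>, so \<open>N\<close> decreases weakly along the greedy sequence.\<close>
      have "span (v ` {..<k}) \<subseteq> span (v ` {..<l})" using that by (intro span_mono) auto
      then have "?N (v l) \<le> ?N (v k)" using that nin v by (intro greedy) auto
      then show ?thesis by (simp add: e_def floor_log_le_iff)
    qed
    show "w \<in> span (v ` {..<k})" if k: "k < n" and w: "w \<in> Zn n" "2 ^ e k *\<^sub>R w \<in> K" for k w
    proof (rule ccontr)
      assume a: "w \<notin> span (v ` {..<k})"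
      then have "w \<noteq> 0" using span_zero[of "v ` {..<k}"] by metis
      then have "2 ^ e k \<le> ?N w" using w by (intro max_multiple_ge[OF K]) auto
      also have "\<dots> \<le> ?N (v k)" using greedy k w a by blast
      also have "\<dots> < 2 ^ e k" using floor_log_exp2_gt[of "?N (v k)"] by (simp add: e_def)
      finally show False by simp
    qed
  qed
  also have "\<dots> \<le> (\<Prod>k<n. 4 * ?N (v k))"
  proof (intro prod_mono conjI)
    fix k assume "k \<in> {..<n}"
    then show "2 ^ Suc (e k) \<le> 4 * ?N (v k)"
      using floor_log_exp2_le[of "?N (v k)"] pos[of k] by (simp add: e_def)
  qed simp
  finally have S_le: "S \<le> 4 ^ n * (\<Prod>k<n. ?N (v k))" by (simp add: prod.distrib)
  define P where "P w = num_points (proj_perp n w ` Zn n) (proj_perp n w ` K)" for w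
  \<comment> \<open>Bounding \<open>S\<close> by the product of the \<open>N(v k)\<close> lets each
    factor be paired with one projection count, and each pair is at most
    \<open>4 ^ n * S\<close>.\<close>
  have "(\<Prod>k<n. P (v k)) * S \<le> (\<Prod>k<n. P (v k)) * (4 ^ n * (\<Prod>k<n. ?N (v k)))"
    using S_le by simp
  also have "\<dots> = 4 ^ n * (\<Prod>k<n. P (v k) * ?N (v k))"
    by (simp add: prod.distrib)
  also have "(\<Prod>k<n. P (v k) * ?N (v k)) \<le> (\<Prod>k<n. 4 ^ n * S)"
    unfolding P_def S_def using v nz by (intro prod_mono conjI num_points_proj_le[OF K] max_multiple_mem[OF K ne]) auto
  also have "4 ^ n * (\<Prod>k<n. 4 ^ n * S) = 4 ^ (n * n + n) * S ^ n"
    by (simp add: power_mult_distrib power_add power_mult)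
  finally have main: "(\<Prod>k<n. P (v k)) * S \<le> 4 ^ (n * n + n) * S ^ n" by simp
  \<comment> \<open>Shifts the indices from \<open>0, ..., n - 1\<close> to
    \<open>1, ..., n\<close>.\<close>
  define v' where "v' = v \<circ> (\<lambda>i. i - 1)"
  have bij: "bij_betw (\<lambda>i. i - 1) {1..n} {..<n}"
    by (rule bij_betwI[of _ _ _ Suc]) auto
  then have image: "(\<lambda>i. i - 1) ` {1..n} = {..<n}" and inj: "inj_on (\<lambda>i. i - 1) {1..n}"
    by (simp_all only: bij_betw_def)
  have P_eq: "(\<Prod>i=1..n. P (v' i)) = (\<Prod>k<n. P (v k))"
    unfolding v'_def o_def using prod.reindex_bij_betw[OF bij, of "\<lambda>k. P (v k)"] .
  have "inj_on v' {1..n}"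
    unfolding v'_def
    by (rule comp_inj_on[OF inj]) (simp only: image independent_image_lessThan(2)[of n v, OF nin])
  moreover have "independent (v' ` {1..n})"
    unfolding v'_def image_comp[symmetric] image
    by (rule independent_image_lessThan(1)[of n v, OF nin])
  moreover have "\<forall>i\<in>{1..n}. v' i \<in> Zn n" using v by (auto simp: v'_def)
  moreover have "real S powr ((real n - 1) / real n)
      \<ge> (1/16) ^ n * real (\<Prod>k<n. P (v k)) powr (1 / real n)"
  proof (rule root_bound[OF n])
    show "real (\<Prod>k<n. P (v k)) * real S \<le> 4 ^ (n * n + n) * real S ^ n"
      using of_nat_mono[OF main, where 'a = real] by (simp only: of_nat_mult of_nat_power of_nat_numeral)
  qed (use S in \<open>simp_all add: prod_nonneg\<close>)
  then have "real (num_points (Zn n) K) powr ((real n - 1) / real n)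
      \<ge> (1/16) ^ n * (\<Prod>i=1..n. real (P (v' i))) powr (1 / real n)"
    unfolding S_def num_points_def P_eq[symmetric] of_nat_prod .
  ultimately show "\<exists>v :: nat \<Rightarrow> nat \<Rightarrow> real.
        (\<forall>i\<in>{1..n}. v i \<in> Zn n) \<and>
        inj_on v {1..n} \<and> independent (v ` {1..n}) \<and>
        real (num_points (Zn n) K) powr ((real n - 1) / real n)
          \<ge> (1/16) ^ n * (\<Prod>i=1..n. real (num_points (proj_perp n (v i) ` Zn n)
                                              (proj_perp n (v i) ` K))) powr (1 / real n)"
    unfolding P_def by blast
qed simp

end
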